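(* Let $p\in(0,\infty]$, $q\in(0,\infty]$ and let $b$ be a slowly varying function. Then $\lVert\cdot\rVert_{(p,q,b)}$ satisfies the property (P4), i.e. $\lVert\chi_E\rVert_{(p,q,b)}<\infty$ for every measurable $E\subseteq R$ with $\mu(E)<\infty$, if and only if one of the following conditions holds: (i) $p\in(1,\infty)$; (ii) $p=1$ and $\lVert t^{-1/q}b(t)\chi_{(1,\infty)}(t)\rVert_q<\infty$; (iii) $p=\infty$ and $\lVert t^{-1/q}b(t)\chi_{(0,1)}(t)\rVert_q<\infty$. Furthermore, if none of these conditions is satisfied, then $L^{(p,q,b)}=\{0\}$.
   Context: $(R,\mu)$ is a $\sigma$-finite non-atomic measure space with $\mu(R)=\infty$; $M=M(R,\mu)$ is the set of extended complex-valued $\mu$-measurable functions on $R$ (identified when equal $\mu$-a.e.). For $f\in M$, $f^*(t)=\inf\{s\ge 0:\mu(\{|f|>s\})\le t\}$ and $f^{**}(t)=\frac1t\int_0^t f^*(s)\,ds$. Convention: $1/\infty=0$. A measurable $b:(0,\infty)\to(0,\infty)$ is slowly varying if for every $\varepsilon>0$ there are a non-decreasing function $b_\varepsilon$ and a non-increasing function $b_{-\varepsilon}$ with $t^\varepsilon b(t)\approx b_\varepsilon(t)$ and $t^{-\varepsilon}b(t)\approx b_{-\varepsilon}(t)$ on $(0,\infty)$, where $\approx$ denotes two-sided estimate up to positive finite multiplicative constants. For $f\in M$, $\lVert f\rVert_{(p,q,b)}=\lVert t^{1/p-1/q}b(t)f^{**}(t)\rVert_q$, where $\lVert\cdot\rVert_q$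 is the Lebesgue $L^q$ (quasi)norm over $(0,\infty)$ with Lebesgue measure (in the variable $t$), and $L^{(p,q,b)}=\{f\in M:\lVert f\rVert_{(p,q,b)}<\infty\}$. *)

theory Defs
  imports "HOL-Analysis.Analysis" "HOL-Probability.Essential_Supremum"
begin

section \<open>Extended complex-valued measurable functions\<close>

datatype ecomplex = Fin_complex complex | Inf_complex

fun ecmod :: "ecomplex \<Rightarrow> ennreal" where
  "ecmod (Fin_complex z) = ennreal (cmod z)"
| "ecmod Inf_complex = \<infinity>"

text \<open>The Borel sigma-algebra of the one-point compactification of the complex plane: a set is
  Borel iff its trace on the complex plane is.\<close>
definition ecomplex_borel :: "ecomplex measure" where
  "ecomplex_borel = sigma UNIV {A. Fin_complex -` A \<in> sets borel}"

definition echi :: "'a set \<Rightarrow> 'a \<Rightarrow> ecomplex" where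
  "echi E x = Fin_complex (indicator E x)"

definition nonatomic :: "'a measure \<Rightarrow> bool" where
  "nonatomic M \<longleftrightarrow> (\<forall>A\<in>sets M. emeasure M A > 0 \<longrightarrow>
     (\<exists>B\<in>sets M. B \<subseteq> A \<and> 0 < emeasure M B \<and> emeasure M B < emeasure M A))"

section \<open>Rearrangements\<close>

definition rearr :: "'a measure \<Rightarrow> ('a \<Rightarrow> ecomplex) \<Rightarrow> real \<Rightarrow> ennreal" where
  "rearr M f t =
     Inf {ennreal s |s::real. 0 \<le> s \<and> emeasure M {x \<in> space M. ecmod (f x) > ennreal s} \<le> ennreal t}"

definition max_rearr :: "'a measure \<Rightarrow> ('a \<Rightarrow> ecomplex) \<Rightarrow> real \<Rightarrow> ennreal" where
  "max_rearr M f t = (\<integral>\<^sup>+ s\<in>{0<..<t}. rearr M f s \<partial>lebesgue) / ennreal t"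

section \<open>Lebesgue quasinorms on the half-line\<close>

text \<open>Only used with a positive real exponent.\<close>
definition ennreal_powr :: "ennreal \<Rightarrow> real \<Rightarrow> ennreal" where
  "ennreal_powr x r = (if x = \<infinity> then \<infinity> else ennreal (enn2real x powr r))"

definition Lq_norm :: "ennreal \<Rightarrow> (real \<Rightarrow> ennreal) \<Rightarrow> ennreal" where
  "Lq_norm q g =
     (if q = \<infinity> then esssup (lebesgue_on {0<..}) g
      else ennreal_powr (\<integral>\<^sup>+ t. ennreal_powr (g t) (enn2real q) \<partial>(lebesgue_on {0<..}))
             (1 / enn2real q))"

text \<open>The real number \<open>1/p\<close> for \<open>p\<close> in \<open>(0,\<infinity>]\<close>; \<open>inverse \<infinity> = 0\<close> in \<^typ>\<open>ennreal\<close>.\<close>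
definition recip :: "ennreal \<Rightarrow> real" where
  "recip p = enn2real (inverse p)"

section \<open>Slowly varying functions\<close>

definition equiv_pos :: "(real \<Rightarrow> real) \<Rightarrow> (real \<Rightarrow> real) \<Rightarrow> bool" where
  "equiv_pos f g \<longleftrightarrow> (\<exists>c>0. \<exists>C>0. \<forall>t>0. c * g t \<le> f t \<and> f t \<le> C * g t)"

definition slowly_varying :: "(real \<Rightarrow> real) \<Rightarrow> bool" where
  "slowly_varying b \<longleftrightarrow>
     b \<in> borel_measurable (lebesgue_on {0<..}) \<and> (\<forall>t>0. 0 < b t) \<and>
     (\<forall>\<epsilon>>0. (\<exists>g. mono_on {0<..} g \<and> equiv_pos (\<lambda>t. t powr \<epsilon> * b t) g) \<and>
            (\<exists>h. antimono_on {0<..} h \<and> equiv_pos (\<lambda>t. t powr (- \<epsilon>) * b t) h))"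

section \<open>Lorentz--Karamata functionals and spaces\<close>

definition LK_norm ::
    "'a measure \<Rightarrow> ennreal \<Rightarrow> ennreal \<Rightarrow> (real \<Rightarrow> real) \<Rightarrow> ('a \<Rightarrow> ecomplex) \<Rightarrow> ennreal" where
  "LK_norm M p q b f =
     Lq_norm q (\<lambda>t. ennreal (t powr (recip p - recip q) * b t) * max_rearr M f t)"

text \<open>As usual for function spaces in HOL, elements are functions rather than equivalence classes
  modulo equality almost everywhere.\<close>
definition LK_space ::
    "'a measure \<Rightarrow> ennreal \<Rightarrow> ennreal \<Rightarrow> (real \<Rightarrow> real) \<Rightarrow> ('a \<Rightarrow> ecomplex) set" where
  "LK_space M p q b = {f \<in> M \<rightarrow>\<^sub>M ecomplex_borel. LK_norm M p q b f < \<infinity>}"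

definition null_class :: "'a measure \<Rightarrow> ('a \<Rightarrow> ecomplex) set" where
  "null_class M = {f \<in> M \<rightarrow>\<^sub>M ecomplex_borel. AE x in M. f x = Fin_complex 0}"

definition property_P4 :: "'a measure \<Rightarrow> (('a \<Rightarrow> ecomplex) \<Rightarrow> ennreal) \<Rightarrow> bool" where
  "property_P4 M N \<longleftrightarrow> (\<forall>E\<in>sets M. emeasure M E < \<infinity> \<longrightarrow> N (echi E) < \<infinity>)"

end

theory Submission
  imports Defs
begin

text \<open>
  The characteristic function of a set of measure \<open>m\<close> has \<open>f\<^sup>*\<^sup>*(t) = min 1 (m / t)\<close>, and every \<open>f\<close>
  that is not null exceeds some \<open>c > 0\<close> on a set of positive measure \<open>m\<close>, so that
  \<open>f\<^sup>*\<^sup>*(t) \<ge> c min 1 (m / t)\<close>. Both claims therefore reduce to the finiteness of the weighted norm of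
  \<open>min 1 (m / t)\<close>, which up to constants is \<open>1\<close> on \<open>(0,1)\<close> and \<open>1/t\<close> on \<open>(1,\<infinity>)\<close>. As \<open>b\<close> is
  dominated by every power, the part near \<open>0\<close> is finite for \<open>p < \<infinity>\<close>, and the part near \<open>\<infinity>\<close> is finite
  for \<open>p > 1\<close> and infinite for \<open>p < 1\<close>; the borderline cases are the conditions (ii) and (iii).
\<close>

section \<open>Powers of extended nonnegative reals and comparison of Lebesgue quasinorms\<close>

abbreviation halfline :: "real measure" where
  "halfline \<equiv> lebesgue_on {0<..}"

lemma ennreal_powr_ennreal [simp]: "0 \<le> a \<Longrightarrow> ennreal_powr (ennreal a) r = ennreal (a powr r)"
  by (simp add: ennreal_powr_def)

lemma ennreal_powr_0 [simp]: "ennreal_powr 0 r = 0"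
  by (simp add: ennreal_powr_def)

lemma ennreal_powr_less_top_iff [simp]: "ennreal_powr x r < top \<longleftrightarrow> x < top"
  by (auto simp: ennreal_powr_def top.not_eq_extremum)

lemma ennreal_powr_mono: "x \<le> y \<Longrightarrow> 0 \<le> r \<Longrightarrow> ennreal_powr x r \<le> ennreal_powr y r"
  by (cases x; cases y) (auto simp: ennreal_powr_def top_unique intro!: ennreal_leI powr_mono2)

lemma measurable_ennreal_powr [measurable]: "(\<lambda>x. ennreal_powr x r) \<in> borel_measurable borel"
  unfolding ennreal_powr_def by measurable

text \<open>Replaces convexity, so that exponents below 1 are covered as well: \<open>x + y\<close>
  is at most twice the larger summand, and the power of the larger summand is at most the sum of
  both powers.\<close>

lemma ennreal_powr_mult_add_le:
  assumes "0 \<le> C" "0 \<le> r"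
  shows "ennreal_powr (ennreal C * (x + y)) r
    \<le> ennreal ((2 * C) powr r) * (ennreal_powr x r + ennreal_powr y r)"
proof (cases "C = 0")
  case False
  then have C: "0 < C" using assms by simp
  show ?thesis
  proof (cases x; cases y)
    fix a c assume xy: "0 \<le> a" "x = ennreal a" "0 \<le> c" "y = ennreal c"
    have "(C * (a + c)) powr r \<le> (2 * C * max a c) powr r"
      using C xy assms by (intro powr_mono2) (auto simp: max_def)
    also have "\<dots> = (2 * C) powr r * max a c powr r"
      using C xy by (subst powr_mult) (auto simp: max_def)
    also have "\<dots> \<le> (2 * C) powr r * (a powr r + c powr r)"
      by (intro mult_left_mono) (auto simp: max_def)
    finally show ?thesis
      using C xy by (simp add: ennreal_mult[symmetric] flip: ennreal_plus)
  qed (use C in \<open>auto simp: ennreal_powr_def ennreal_mult_top\<close>)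
qed (simp add: assms)

lemma recip_ennreal: "0 < r \<Longrightarrow> recip (ennreal r) = 1 / r"
  by (simp add: recip_def inverse_ennreal inverse_eq_divide)

lemma recip_top [simp]: "recip top = 0"
  by (simp add: recip_def)

lemma recip_1 [simp]: "recip 1 = 1"
  by (simp add: recip_def)

lemma Lq_norm_top: "Lq_norm top g = esssup halfline g"
  by (simp add: Lq_norm_def)

lemma Lq_norm_ennreal_less_top_iff:
  "0 < r \<Longrightarrow> Lq_norm (ennreal r) g < top \<longleftrightarrow> (\<integral>\<^sup>+ t. ennreal_powr (g t) r \<partial>halfline) < top"
  by (simp add: Lq_norm_def)

text \<open>Stands in for the quasi-triangle inequality. Only finiteness is tracked, so the same
  form serves \<open>q < 1\<close>, \<open>q \<ge> 1\<close> and \<open>q = top\<close>: finite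
  exponents integrate the pointwise power bound, and \<open>top\<close> adds the essential
  suprema.\<close>

lemma Lq_norm_dominated:
  assumes q: "0 < q" and C: "0 \<le> C"
    and [measurable]: "g \<in> borel_measurable halfline" "h \<in> borel_measurable halfline"
      "k \<in> borel_measurable halfline"
    and le: "\<And>t. 0 < t \<Longrightarrow> g t \<le> ennreal C * (h t + k t)"
    and h: "Lq_norm q h < top" and k: "Lq_norm q k < top"
  shows "Lq_norm q g < top"
proof (cases q)
  case top
  have "AE t in halfline. g t \<le> ennreal C * (esssup halfline h + esssup halfline k)"
    using esssup_AE[of h halfline] esssup_AE[of k halfline] AE_space
  proof eventually_elim
    case (elim t)
    then have "g t \<le> ennreal C * (h t + k t)" by (intro le) simp
    also have "\<dots> \<le> ennreal C * (esssup halfline h + esssup halfline k)"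
      using elim by (intro mult_left_mono add_mono) auto
    finally show ?case .
  qed
  then have "esssup halfline g \<le> ennreal C * (esssup halfline h + esssup halfline k)"
    by (intro esssup_I) auto
  also have "\<dots> < top"
    using h k top by (simp add: Lq_norm_top ennreal_mult_less_top)
  finally show ?thesis using top by (simp add: Lq_norm_top)
next
  case (real r)
  with q have r: "0 < r" by simp
  have "(\<integral>\<^sup>+ t. ennreal_powr (g t) r \<partial>halfline)
      \<le> (\<integral>\<^sup>+ t. ennreal ((2 * C) powr r) * (ennreal_powr (h t) r + ennreal_powr (k t) r) \<partial>halfline)"
    using r C by (intro nn_integral_mono order_trans[OF ennreal_powr_mono[OF le]]
        ennreal_powr_mult_add_le) auto
  also have "\<dots> = ennreal ((2 * C) powr r) *
      ((\<integral>\<^sup>+ t. ennreal_powr (h t) r \<partial>halfline) + (\<integral>\<^sup>+ t. ennreal_powr (k t) r \<partial>halfline))"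
    by (simp add: nn_integral_cmult nn_integral_add)
  also have "\<dots> < top"
    using h k r real by (simp add: Lq_norm_ennreal_less_top_iff ennreal_mult_less_top)
  finally show ?thesis using r real by (simp add: Lq_norm_ennreal_less_top_iff)
qed

lemma Lq_norm_0: "Lq_norm q (\<lambda>t. 0) = 0"
proof -
  have "esssup halfline (\<lambda>t. 0 :: ennreal) \<le> 0"
    by (rule esssup_I) auto
  then show ?thesis by (simp add: Lq_norm_def)
qed

lemma Lq_norm_dominated1:
  assumes "0 < q" "0 \<le> C"
    and "g \<in> borel_measurable halfline" "h \<in> borel_measurable halfline"
    and "\<And>t. 0 < t \<Longrightarrow> g t \<le> ennreal C * h t"
    and "Lq_norm q h < top"
  shows "Lq_norm q g < top"
  by (rule Lq_norm_dominated[where k = "\<lambda>t. 0", OF assms(1-4)])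
     (use assms in \<open>auto simp: Lq_norm_0\<close>)

text \<open>Measurability is asked of the smaller function alone, because \<open>h\<close> will be
  the weighted \<open>max_rearr M f\<close> of an arbitrary \<open>f\<close>. The essential supremum
  of a non-measurable function is \<open>top\<close>, which keeps the inequality true.\<close>

lemma Lq_norm_mono:
  assumes [measurable]: "g \<in> borel_measurable halfline"
    and le: "\<And>t. 0 < t \<Longrightarrow> g t \<le> h t"
  shows "Lq_norm q g \<le> Lq_norm q h"
proof (cases "q = top")
  case True
  then show ?thesis
    using AE_I2[of halfline "\<lambda>t. g t \<le> h t"] le by (auto simp: Lq_norm_top intro!: esssup_AE_mono)
next
  case False
  have "(\<integral>\<^sup>+ t. ennreal_powr (g t) (enn2real q) \<partial>halfline)
      \<le> (\<integral>\<^sup>+ t. ennreal_powr (h t) (enn2real q) \<partial>halfline)"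
    by (intro nn_integral_mono ennreal_powr_mono le) auto
  with False show ?thesis by (auto simp: Lq_norm_def intro!: ennreal_powr_mono)
qed

section \<open>Power weights near zero and near infinity\<close>

lemma measurable_powr_halfline [measurable]:
  "(\<lambda>t. t powr a) \<in> borel_measurable halfline" for a :: real
  by (intro measurable_restrict_space1 measurable_completion) simp

lemma measurable_min_divide_halfline [measurable]:
  "(\<lambda>t. min 1 (m / t)) \<in> borel_measurable halfline" for m :: real
  by (intro measurable_restrict_space1 measurable_completion) simp

lemma measurable_indicator_halfline [measurable]:
  "S \<in> sets borel \<Longrightarrow> (indicator S :: real \<Rightarrow> real) \<in> borel_measurable halfline"
  by (intro measurable_restrict_space1 measurable_completion) simp

text \<open>The shift by \<open>recip q\<close> turns the \<open>r\<close>-th power of the weight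
  into \<open>t powr (a * r - 1)\<close>, integrable at 0 since \<open>a * r > 0\<close>. For
  \<open>q = top\<close> the weight is \<open>t powr a\<close>, at most 1 on the interval.\<close>

lemma Lq_norm_powr_near_0:
  assumes q: "0 < q" and a: "0 < a"
  shows "Lq_norm q (\<lambda>t. ennreal (t powr (a - recip q) * indicator {0<..1} t)) < top"
proof (cases q)
  case top
  have "esssup halfline (\<lambda>t. ennreal (t powr a * indicator {0<..1} t)) \<le> 1"
    using a by (intro esssup_I AE_I2, simp, auto simp: indicator_def powr_le1)
  also have "\<dots> < top" by simp
  finally show ?thesis using top by (simp add: Lq_norm_top)
next
  case (real r)
  with q have r: "0 < r" by simp
  have *: "ennreal_powr (ennreal (t powr (a - 1 / r) * indicator {0<..1} t)) r * indicator {0<..} t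
      = ennreal (t powr (a * r - 1)) * indicator {0<..1} t" for t
    using r by (auto simp: indicator_def powr_powr algebra_simps)
  have "(\<integral>\<^sup>+ t. ennreal_powr (ennreal (t powr (a - 1 / r) * indicator {0<..1} t)) r \<partial>halfline)
      = (\<integral>\<^sup>+ t. ennreal (t powr (a * r - 1)) * indicator {0<..1} t \<partial>lebesgue)"
    by (subst nn_integral_restrict_space) (simp_all only: *, simp)
  also have "\<dots> \<le> (\<integral>\<^sup>+ t. ennreal (t powr (a * r - 1)) * indicator {0..1} t \<partial>lborel)"
    unfolding nn_integral_completion by (intro nn_integral_mono) (auto simp: indicator_def)
  also have "\<dots> = ennreal (1 powr (a * r - 1 + 1) / (a * r - 1 + 1))"
    using a r by (intro nn_integral_has_integral_lebesgue' has_integral_powr_from_0) auto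
  also have "\<dots> < top" by simp
  finally show ?thesis using r real by (simp add: Lq_norm_ennreal_less_top_iff recip_ennreal)
qed

text \<open>Mirror image of the estimate near 0: the integrand becomes
  \<open>t powr (- a * r - 1)\<close>, integrable at infinity.\<close>

lemma Lq_norm_powr_near_infinity:
  assumes q: "0 < q" and a: "0 < a"
  shows "Lq_norm q (\<lambda>t. ennreal (t powr (- a - recip q) * indicator {1..} t)) < top"
proof (cases q)
  case top
  have "esssup halfline (\<lambda>t. ennreal (t powr (- a) * indicator {1..} t)) \<le> 1"
    using a by (intro esssup_I AE_I2, simp,
      auto simp: indicator_def powr_minus inverse_le_1_iff ge_one_powr_ge_zero)
  also have "\<dots> < top" by simp
  finally show ?thesis using top by (simp add: Lq_norm_top)
next
  case (real r)
  with q have r: "0 < r" by simp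
  have *: "ennreal_powr (ennreal (t powr (- a - 1 / r) * indicator {1..} t)) r * indicator {0<..} t
      = ennreal (t powr (- a * r - 1)) * indicator {1..} t" for t
    using r by (auto simp: indicator_def powr_powr algebra_simps)
  have "(\<integral>\<^sup>+ t. ennreal_powr (ennreal (t powr (- a - 1 / r) * indicator {1..} t)) r \<partial>halfline)
      = (\<integral>\<^sup>+ t. ennreal (t powr (- a * r - 1)) * indicator {1..} t \<partial>lborel)"
    by (subst nn_integral_restrict_space) (simp_all only: * nn_integral_completion, simp)
  also have "\<dots> = ennreal (- (1 powr (- a * r - 1 + 1)) / (- a * r - 1 + 1))"
    using a r by (intro nn_integral_has_integral_lebesgue' has_integral_powr_to_inf) auto
  also have "\<dots> < top" by simp
  finally show ?thesis using r real by (simp add: Lq_norm_ennreal_less_top_iff recip_ennreal)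
qed

lemma nn_integral_inverse_at_infinity:
  "(\<integral>\<^sup>+ t. ennreal (1 / t) * indicator {1<..} t \<partial>lborel) = top"
proof (rule ccontr)
  let ?I = "\<integral>\<^sup>+ t. ennreal (1 / t) * indicator {1<..} t \<partial>lborel"
  assume "?I \<noteq> top"
  then obtain B where B: "?I = ennreal B" "0 \<le> B" by (cases ?I) auto
  \<comment> \<open>If the integral were \<open>B\<close>, cutting it off at
    \<open>exp (B + 1)\<close> would already give \<open>B + 1\<close>.\<close>
  have "ennreal (ln (exp (B + 1)) - ln 1)
      = (\<integral>\<^sup>+ t. ennreal (1 / t) * indicator {1..exp (B + 1)} t \<partial>lborel)"
    using B by (intro nn_integral_FTC_Icc[symmetric])
      (auto intro!: derivative_eq_intros simp flip: has_real_derivative_iff_has_vector_derivative)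
  also have "\<dots> \<le> ?I"
    \<comment> \<open>The closed interval used for the antiderivative contains the endpoint 1, which
      is a null set.\<close>
    using AE_lborel_singleton[of 1]
    by (intro nn_integral_mono_AE) (auto elim!: eventually_mono simp: indicator_def)
  finally show False using B by simp
qed

lemma Lq_norm_powr_diverges:
  assumes q: "0 < q" and a: "0 < a"
  shows "Lq_norm q (\<lambda>t. ennreal (t powr (a - recip q) * indicator {1<..} t)) = top"
proof (cases q)
  case top
  show ?thesis
  proof (rule ccontr)
    let ?S = "esssup halfline (\<lambda>t. ennreal (t powr a * indicator {1<..} t))"
    assume "\<not> ?thesis"
    then obtain B where B: "?S = ennreal B" "0 \<le> B" using top by (cases ?S) (auto simp: Lq_norm_top)
    have "AE t in halfline. ennreal (t powr a * indicator {1<..} t) \<le> ennreal B"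
      using esssup_AE[of "\<lambda>t. ennreal (t powr a * indicator {1<..} t)" halfline] B by simp
    then have "AE t in lebesgue. 0 < t \<longrightarrow> ennreal (t powr a * indicator {1<..} t) \<le> ennreal B"
      by (subst (asm) AE_restrict_space_iff) auto
    \<comment> \<open>Beyond \<open>(B + 1) powr (1 / a)\<close> the weight is at least
      \<open>B + 1\<close>, so an essential bound \<open>B\<close> would make this interval of
      length 1 a null set.\<close>
    then have AE: "AE t in lebesgue. t \<notin> {(B + 1) powr (1 / a)<..<(B + 1) powr (1 / a) + 1}"
    proof eventually_elim
      case (elim t)
      show ?case
      proof
        assume t: "t \<in> {(B + 1) powr (1 / a)<..<(B + 1) powr (1 / a) + 1}"
        have "1 \<le> (B + 1) powr (1 / a)" using B a by (intro ge_one_powr_ge_zero) auto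
        with t have t1: "1 < t" by auto
        have "B + 1 = ((B + 1) powr (1 / a)) powr a" using B a by (simp add: powr_powr)
        also have "\<dots> \<le> t powr a" using t a by (intro powr_mono2) auto
        finally show False using elim t1 B by (simp add: ennreal_le_iff)
      qed
    qed
    have "emeasure lebesgue {(B + 1) powr (1 / a)<..<(B + 1) powr (1 / a) + 1} = 0"
      using AE by (intro AE_iff_measurable[THEN iffD1, OF _ _ AE]) auto
    then show False by simp
  qed
next
  case (real r)
  with q have r: "0 < r" by simp
  \<comment> \<open>The \<open>r\<close>-th power of the weight is
    \<open>t powr (a * r - 1)\<close>, which dominates \<open>1 / t\<close> for
    \<open>t > 1\<close>.\<close>
  have "ennreal (1 / t) * indicator {1<..} t
      \<le> ennreal_powr (ennreal (t powr (a - 1 / r) * indicator {1<..} t)) r * indicator {0<..} t" for t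
  proof (cases "1 < t")
    case True
    have "1 / t = t powr (- 1)" using True by (simp add: powr_minus_divide)
    also have "\<dots> \<le> t powr ((a - 1 / r) * r)"
      using True a r by (intro powr_mono) (auto simp: algebra_simps)
    finally show ?thesis using True by (simp add: powr_powr)
  qed simp
  then have "(\<integral>\<^sup>+ t. ennreal (1 / t) * indicator {1<..} t \<partial>lebesgue)
      \<le> (\<integral>\<^sup>+ t. ennreal_powr (ennreal (t powr (a - 1 / r) * indicator {1<..} t)) r \<partial>halfline)"
    by (subst nn_integral_restrict_space) (auto intro!: nn_integral_mono)
  then have "\<not> (\<integral>\<^sup>+ t. ennreal_powr (ennreal (t powr (a - 1 / r) * indicator {1<..} t)) r \<partial>halfline) < top"
    by (simp add: nn_integral_completion nn_integral_inverse_at_infinity top_unique)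
  then have "\<not> Lq_norm q (\<lambda>t. ennreal (t powr (a - recip q) * indicator {1<..} t)) < top"
    using r real by (simp add: Lq_norm_ennreal_less_top_iff recip_ennreal)
  then show ?thesis using top.not_eq_extremum by blast
qed

section \<open>Power bounds for slowly varying functions\<close>

text \<open>The monotone equivalents of \<open>t powr e * b t\<close> and
  \<open>t powr (- e) * b t\<close> are compared with their values at 1: the first gives the upper
  bound on the left of 1 and the lower bound on the right, the second the upper bound on the
  right.\<close>

lemma slowly_varying_bounds:
  assumes b: "slowly_varying b" and e: "0 < e"
  obtains c C where "0 < c" "0 < C"
    "\<And>t. 0 < t \<Longrightarrow> t \<le> 1 \<Longrightarrow> b t \<le> C * t powr (- e)"
    "\<And>t. 1 \<le> t \<Longrightarrow> b t \<le> C * t powr e"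
    "\<And>t. 1 \<le> t \<Longrightarrow> c * t powr (- e) \<le> b t"
proof -
  obtain g h where g: "mono_on {0<..} g" "equiv_pos (\<lambda>t. t powr e * b t) g"
    and h: "antimono_on {0<..} h" "equiv_pos (\<lambda>t. t powr (- e) * b t) h"
    using b e unfolding slowly_varying_def by blast
  obtain k K where k: "0 < k" "0 < K"
    "\<And>t. 0 < t \<Longrightarrow> k * g t \<le> t powr e * b t" "\<And>t. 0 < t \<Longrightarrow> t powr e * b t \<le> K * g t"
    using g(2) unfolding equiv_pos_def by blast
  obtain L where L: "0 < L" "\<And>t. 0 < t \<Longrightarrow> t powr (- e) * b t \<le> L * h t"
    using h(2) unfolding equiv_pos_def by blast
  have b1: "0 < b 1" using b by (simp add: slowly_varying_def)
  \<comment> \<open>The sign of \<open>g\<close> and \<open>h\<close> is not part of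
    \<open>equiv_pos\<close>; it is recovered at 1 from \<open>0 < b 1\<close>.\<close>
  have "0 < K * g 1" "0 < L * h 1" using k(4)[of 1] L(2)[of 1] b1 by auto
  then have pos: "0 < g 1" "0 < h 1" using k L by (auto simp: zero_less_mult_iff)
  define C where "C = max (K * g 1) (L * h 1)"
  show thesis
  proof
    show "0 < k * g 1" using k pos by simp
    show "0 < C" using k pos by (simp add: C_def less_max_iff_disj)
    show "b t \<le> C * t powr (- e)" if t: "0 < t" "t \<le> 1" for t
    proof -
      have "t powr e * b t \<le> K * g t" using t k by simp
      also have "\<dots> \<le> K * g 1" using t k g(1) by (intro mult_left_mono) (auto simp: mono_on_def)
      also have "\<dots> \<le> C" by (simp add: C_def)
      finally show ?thesis using t by (simp add: powr_minus field_simps)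
    qed
    show "b t \<le> C * t powr e" if t: "1 \<le> t" for t
    proof -
      have "t powr (- e) * b t \<le> L * h t" using t L by simp
      also have "\<dots> \<le> L * h 1" using t L h(1) by (intro mult_left_mono) (auto simp: monotone_on_def)
      also have "\<dots> \<le> C" by (simp add: C_def)
      finally show ?thesis using t by (simp add: powr_minus field_simps)
    qed
    show "k * g 1 * t powr (- e) \<le> b t" if t: "1 \<le> t" for t
    proof -
      have "k * g 1 \<le> k * g t" using t k g(1) by (intro mult_left_mono) (auto simp: mono_on_def)
      also have "\<dots> \<le> t powr e * b t" using t k by simp
      finally show ?thesis using t by (simp add: powr_minus field_simps)
    qed
  qed
qed

lemma slowly_varying_pos: "slowly_varying b \<Longrightarrow> 0 < t \<Longrightarrow> 0 < b t"
  by (simp add: slowly_varying_def)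

lemma slowly_varying_measurable: "slowly_varying b \<Longrightarrow> b \<in> borel_measurable halfline"
  by (simp add: slowly_varying_def)

section \<open>Weighted quasinorms with a slowly varying factor\<close>

context
  fixes b :: "real \<Rightarrow> real" and q :: ennreal
  assumes b: "slowly_varying b" and q: "0 < q"
begin

lemmas [measurable] = slowly_varying_measurable[OF b]

text \<open>Half of the exponent \<open>a\<close> absorbs \<open>b\<close>; the other half keeps the
  remaining power weight finite. The next two lemmas split \<open>a\<close> in the same way.\<close>

lemma Lq_norm_sv_near_0:
  assumes a: "0 < a"
  shows "Lq_norm q (\<lambda>t. ennreal (t powr (a - recip q) * b t * indicator {0<..1} t)) < top"
proof -
  from a have a2: "0 < a / 2" by simp
  from slowly_varying_bounds[OF b a2] obtain C where C: "0 < C"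
    "\<And>t. 0 < t \<Longrightarrow> t \<le> 1 \<Longrightarrow> b t \<le> C * t powr (- (a / 2))"
    by metis
  show ?thesis
  proof (rule Lq_norm_dominated1[OF q _ _ _ _ Lq_norm_powr_near_0[OF q a2]])
    show "ennreal (t powr (a - recip q) * b t * indicator {0<..1} t)
        \<le> ennreal C * ennreal (t powr (a / 2 - recip q) * indicator {0<..1} t)" for t
    proof (cases "t \<in> {0<..1}")
      case True
      have "t powr (a - recip q) * b t \<le> t powr (a - recip q) * (C * t powr (- (a / 2)))"
        using True C by (intro mult_left_mono) auto
      also have "\<dots> = C * t powr (a / 2 - recip q)"
        by (simp flip: powr_add)
      finally show ?thesis using True C by (simp add: ennreal_mult[symmetric] ennreal_leI)
    qed simp
  qed (use C in auto)
qed

lemma Lq_norm_sv_near_infinity: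
  assumes a: "0 < a"
  shows "Lq_norm q (\<lambda>t. ennreal (t powr (- a - recip q) * b t * indicator {1..} t)) < top"
proof -
  from a have a2: "0 < a / 2" by simp
  from slowly_varying_bounds[OF b a2] obtain C where C: "0 < C"
    "\<And>t. 1 \<le> t \<Longrightarrow> b t \<le> C * t powr (a / 2)"
    by metis
  show ?thesis
  proof (rule Lq_norm_dominated1[OF q _ _ _ _ Lq_norm_powr_near_infinity[OF q a2]])
    show "ennreal (t powr (- a - recip q) * b t * indicator {1..} t)
        \<le> ennreal C * ennreal (t powr (- (a / 2) - recip q) * indicator {1..} t)" for t
    proof (cases "1 \<le> t")
      case True
      have "t powr (- a - recip q) * b t \<le> t powr (- a - recip q) * (C * t powr (a / 2))"
        using True C by (intro mult_left_mono) auto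
      also have "\<dots> = C * t powr (- (a / 2) - recip q)"
        by (simp flip: powr_add)
      finally show ?thesis using True C by (simp add: ennreal_mult[symmetric] ennreal_leI)
    qed simp
  qed (use C in auto)
qed

text \<open>Here the lower power bound for \<open>b\<close> is used: \<open>b\<close> can cost at
  most half of the exponent, and the half that is left still diverges.\<close>

lemma Lq_norm_sv_diverges:
  assumes a: "0 < a"
  shows "Lq_norm q (\<lambda>t. ennreal (t powr (a - recip q) * b t * indicator {1<..} t)) = top"
proof (rule ccontr)
  assume "\<not> ?thesis"
  then have fin: "Lq_norm q (\<lambda>t. ennreal (t powr (a - recip q) * b t * indicator {1<..} t)) < top"
    using top.not_eq_extremum by blast
  from a have a2: "0 < a / 2" by simp
  from slowly_varying_bounds[OF b a2] obtain c where c: "0 < c"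
    "\<And>t. 1 \<le> t \<Longrightarrow> c * t powr (- (a / 2)) \<le> b t"
    by metis
  have "Lq_norm q (\<lambda>t. ennreal (t powr (a / 2 - recip q) * indicator {1<..} t)) < top"
  proof (rule Lq_norm_dominated1[OF q _ _ _ _ fin])
    show "ennreal (t powr (a / 2 - recip q) * indicator {1<..} t)
        \<le> ennreal (1 / c) * ennreal (t powr (a - recip q) * b t * indicator {1<..} t)" for t
    proof (cases "1 < t")
      case True
      have "c * t powr (a / 2 - recip q) = t powr (a - recip q) * (c * t powr (- (a / 2)))"
        by (simp flip: powr_add)
      also have "\<dots> \<le> t powr (a - recip q) * b t"
        using True c by (intro mult_left_mono) auto
      finally show ?thesis
        using True c slowly_varying_pos[OF b, of t] by (simp add: ennreal_mult[symmetric] ennreal_leI field_simps)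
    qed simp
  qed (use c in auto)
  with Lq_norm_powr_diverges[OF q a2] show False by simp
qed

lemma Lq_norm_min_finite:
  assumes m: "0 \<le> m"
    and cond: "(1 < p \<and> p < top) \<or>
      (p = 1 \<and> Lq_norm q (\<lambda>t. ennreal (t powr (- recip q) * b t * indicator {1<..} t)) < top) \<or>
      (p = top \<and> Lq_norm q (\<lambda>t. ennreal (t powr (- recip q) * b t * indicator {0<..<1} t)) < top)"
  shows "Lq_norm q (\<lambda>t. ennreal (t powr (recip p - recip q) * b t) * ennreal (min 1 (m / t))) < top"
proof -
  \<comment> \<open>The half-line is split at 1 into \<open>S\<close> and \<open>T\<close>. Both
    stay variable because the point 1 must be assigned differently in each case to match the open
    intervals in the conditions; an overlap at 1 is harmless.\<close>
  have bound: "Lq_norm q (\<lambda>t. ennreal (t powr (recip p - recip q) * b t) * ennreal (min 1 (m / t))) < top"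
    if S: "S \<in> sets borel" "T \<in> sets borel" "S \<subseteq> {0<..1}" "T \<subseteq> {1..}" "S \<union> T = {0<..}"
      and 0: "Lq_norm q (\<lambda>t. ennreal (t powr (recip p - recip q) * b t * indicator S t)) < top"
      and 1: "Lq_norm q (\<lambda>t. ennreal (t powr (recip p - 1 - recip q) * b t * indicator T t)) < top"
    for S T
  proof (rule Lq_norm_dominated[OF q _ _ _ _ _ 0 1])
    fix t :: real assume t: "0 < t"
    note bt = slowly_varying_pos[OF b t]
    have eq: "t powr (recip p - 1 - recip q) = t powr (recip p - recip q) / t"
      using powr_diff[of t "recip p - recip q" 1] t by (simp add: algebra_simps)
    have "ennreal (t powr (recip p - recip q) * b t) * ennreal (min 1 (m / t))
        = ennreal (t powr (recip p - recip q) * b t * min 1 (m / t))"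
      using t m bt by (subst ennreal_mult) (auto simp: min_def)
    also have "\<dots> \<le> ennreal (max 1 m * (t powr (recip p - recip q) * b t * indicator S t
        + t powr (recip p - 1 - recip q) * b t * indicator T t))"
    proof (rule ennreal_leI)
      \<comment> \<open>On \<open>S\<close> the bound 1 suffices; on the rest \<open>m / t\<close>
        is used. The constant \<open>max 1 m\<close> covers both, and the factor
        \<open>1 / t\<close> lowers the exponent of the weight by 1.\<close>
      have "min 1 (m / t) \<le> max 1 m * (indicator S t + indicator T t / t)"
      proof (cases "t \<in> S")
        case True
        have "min 1 (m / t) \<le> max 1 m * 1" by simp
        also have "\<dots> \<le> max 1 m * (indicator S t + indicator T t / t)"
          using True t by (intro mult_left_mono) auto
        finally show ?thesis .
      next
        case False
        then have "t \<in> T" using S t by auto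
        with False t show ?thesis by (auto simp: min_def max_def field_simps)
      qed
      then have "(t powr (recip p - recip q) * b t) * min 1 (m / t)
        \<le> (t powr (recip p - recip q) * b t) * (max 1 m * (indicator S t + indicator T t / t))"
        using bt by (intro mult_left_mono) auto
      then show "t powr (recip p - recip q) * b t * min 1 (m / t)
        \<le> max 1 m * (t powr (recip p - recip q) * b t * indicator S t
          + t powr (recip p - 1 - recip q) * b t * indicator T t)"
        unfolding eq by (simp add: algebra_simps)
    qed
    also have "\<dots> = ennreal (max 1 m) * (ennreal (t powr (recip p - recip q) * b t * indicator S t)
        + ennreal (t powr (recip p - 1 - recip q) * b t * indicator T t))"
      using bt t by (subst ennreal_mult) (auto simp flip: ennreal_plus)
    finally show "ennreal (t powr (recip p - recip q) * b t) * ennreal (min 1 (m / t)) \<le> \<dots>" .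
  qed (use S m in auto)
  have near_infinity: "Lq_norm q (\<lambda>t. ennreal (t powr (recip p - 1 - recip q) * b t * indicator {1..} t)) < top"
    if "recip p < 1"
    using Lq_norm_sv_near_infinity[of "1 - recip p"] that by simp
  from cond consider "1 < p" "p < top"
    | "p = 1" "Lq_norm q (\<lambda>t. ennreal (t powr (- recip q) * b t * indicator {1<..} t)) < top"
    | "p = top" "Lq_norm q (\<lambda>t. ennreal (t powr (- recip q) * b t * indicator {0<..<1} t)) < top"
    by blast
  then show ?thesis
  proof cases
    case 1
    then obtain r where r: "p = ennreal r" "1 < r" by (cases p) auto
    then have "0 < recip p" "recip p < 1" by (auto simp: recip_ennreal)
    then show ?thesis
      by (intro bound[of "{0<..1}" "{1..}"] Lq_norm_sv_near_0 near_infinity) auto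
  next
    \<comment> \<open>For \<open>p = 1\<close> the weight at infinity has exponent
      \<open>- recip q\<close>, which is the assumed condition, while the part near 0 has the
      surplus exponent 1. For \<open>p = top\<close> the roles are exchanged.\<close>
    case 2
    then show ?thesis
      using Lq_norm_sv_near_0[of 1] by (intro bound[of "{0<..1}" "{1<..}"]) auto
  next
    case 3
    then show ?thesis
      using near_infinity by (intro bound[of "{0<..<1}" "{1..}"]) auto
  qed
qed

text \<open>Finiteness of the whole quasinorm passes to its restrictions to \<open>{0<..<1}\<close>
  and \<open>{1<..}\<close>; for every remaining \<open>p\<close> one of these contradicts either
  \<open>cond\<close> or the divergence of power weights.\<close>

lemma Lq_norm_min_infinite:
  assumes m: "0 < m" and p: "0 < p"
    and cond: "\<not> ((1 < p \<and> p < top) \<or>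
      (p = 1 \<and> Lq_norm q (\<lambda>t. ennreal (t powr (- recip q) * b t * indicator {1<..} t)) < top) \<or>
      (p = top \<and> Lq_norm q (\<lambda>t. ennreal (t powr (- recip q) * b t * indicator {0<..<1} t)) < top))"
  shows "Lq_norm q (\<lambda>t. ennreal (t powr (recip p - recip q) * b t) * ennreal (min 1 (m / t))) = top"
proof (rule ccontr)
  assume "\<not> ?thesis"
  then have fin:
    "Lq_norm q (\<lambda>t. ennreal (t powr (recip p - recip q) * b t) * ennreal (min 1 (m / t))) < top"
    using top.not_eq_extremum by blast
  \<comment> \<open>Chosen so that \<open>min 1 (m / t)\<close> is at least \<open>c\<close> for
    \<open>t < 1\<close> and at least \<open>c / t\<close> for \<open>t > 1\<close>.\<close>
  define c where "c = min 1 m"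
  have c: "0 < c" using m by (simp add: c_def)
  have bound: "Lq_norm q (\<lambda>t. ennreal (t powr d * b t * indicator S t)) < top"
    if S: "S \<in> sets borel"
      and le: "\<And>t. 0 < t \<Longrightarrow> t \<in> S \<Longrightarrow> c * t powr d \<le> t powr (recip p - recip q) * min 1 (m / t)"
    for S d
  proof (rule Lq_norm_dominated1[OF q _ _ _ _ fin])
    fix t :: real assume t: "0 < t"
    note bt = slowly_varying_pos[OF b t]
    show "ennreal (t powr d * b t * indicator S t)
        \<le> ennreal (1 / c) * (ennreal (t powr (recip p - recip q) * b t) * ennreal (min 1 (m / t)))"
    proof (cases "t \<in> S")
      case True
      have "c * t powr d * b t \<le> t powr (recip p - recip q) * min 1 (m / t) * b t"
        using le[OF t True] bt by (intro mult_right_mono) auto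
      then have "t powr d * b t \<le> 1 / c * (t powr (recip p - recip q) * b t * min 1 (m / t))"
        using c by (simp add: field_simps)
      also have "ennreal \<dots>
        = ennreal (1 / c) * (ennreal (t powr (recip p - recip q) * b t) * ennreal (min 1 (m / t)))"
        using c bt t m by (simp add: ennreal_mult[symmetric] del: min_divide_distrib_right)
      finally show ?thesis using True by (simp add: ennreal_leI)
    qed simp
  qed (use S c in auto)
  \<comment> \<open>This holds for every \<open>p\<close>. At \<open>p = 1\<close> it is the negated
    condition itself, and for \<open>p < 1\<close> the exponent \<open>recip p - 1\<close> is
    positive, which forces divergence.\<close>
  have large: "Lq_norm q (\<lambda>t. ennreal (t powr (recip p - 1 - recip q) * b t * indicator {1<..} t)) < top"
  proof (rule bound)
    fix t :: real assume t: "0 < t" "t \<in> {1<..}"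
    have eq: "t powr (recip p - 1 - recip q) = t powr (recip p - recip q) / t"
      using powr_diff[of t "recip p - recip q" 1] t by (simp add: algebra_simps)
    from t have "c / t \<le> min 1 (m / t)" using m by (auto simp: c_def min_def field_simps)
    then have "t powr (recip p - recip q) * (c / t) \<le> t powr (recip p - recip q) * min 1 (m / t)"
      by (intro mult_left_mono) auto
    then show "c * t powr (recip p - 1 - recip q) \<le> t powr (recip p - recip q) * min 1 (m / t)"
      unfolding eq by (simp add: mult.commute)
  qed simp
  consider "p = top" | "p = 1" | r where "p = ennreal r" "0 < r" "r < 1"
    using cond p by (cases p) (auto simp: not_less le_less ennreal_less_one_iff)
  then show False
  proof cases
    case 1
    have "Lq_norm q (\<lambda>t. ennreal (t powr (- recip q) * b t * indicator {0<..<1} t)) < top"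
    proof (rule bound)
      fix t :: real assume t: "0 < t" "t \<in> {0<..<1}"
      then have "c \<le> min 1 (m / t)" using m by (auto simp: c_def min_def field_simps)
      then have "t powr (- recip q) * c \<le> t powr (- recip q) * min 1 (m / t)"
        by (intro mult_left_mono) auto
      then show "c * t powr (- recip q) \<le> t powr (recip p - recip q) * min 1 (m / t)"
        using 1 by (simp add: mult.commute)
    qed simp
    with cond 1 show False by simp
  next
    case 2
    with large cond show False by simp
  next
    case 3
    then have "0 < recip p - 1" by (simp add: recip_ennreal)
    from Lq_norm_sv_diverges[OF this] large show False by simp
  qed
qed

end

section \<open>Rearrangements of characteristic functions and lower bounds by them\<close>

text \<open>The averaged step function serves twice: with \<open>c = 1\<close> it is the
  rearrangement of a characteristic function, and for general \<open>c\<close> it is a minorant of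
  the rearrangement of a function with a large level set.\<close>

lemma nn_integral_indicator_average:
  assumes t: "0 < t" and m: "0 \<le> m"
  shows "(\<integral>\<^sup>+ s\<in>{0<..<t}. ennreal c * indicator {..<m} s \<partial>lebesgue) / ennreal t
    = ennreal c * ennreal (min 1 (m / t))"
proof -
  have "(\<integral>\<^sup>+ s\<in>{0<..<t}. ennreal c * indicator {..<m} s \<partial>lebesgue)
      = (\<integral>\<^sup>+ s. ennreal c * indicator {0<..<min t m} s \<partial>lebesgue)"
    by (intro nn_integral_cong) (auto simp: indicator_def)
  also have "\<dots> = ennreal c * ennreal (min t m)"
    using t m by (subst nn_integral_cmult_indicator) auto
  also have "\<dots> / ennreal t = ennreal c * (ennreal (min t m) / ennreal t)"
    by (simp add: ennreal_times_divide)
  also have "ennreal (min t m) / ennreal t = ennreal (min 1 (m / t))"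
    using t m by (subst divide_ennreal) (auto simp: min_def field_simps)
  finally show ?thesis .
qed

text \<open>Membership in \<open>ecomplex_borel\<close> is decided by the trace on the finite plane,
  where \<open>ecmod\<close> is the usual modulus; the generating family already contains the
  preimage.\<close>

lemma measurable_ecmod [measurable]: "ecmod \<in> borel_measurable ecomplex_borel"
proof -
  show ?thesis
  proof (rule measurableI)
    fix A :: "ennreal set" assume [measurable]: "A \<in> sets borel"
    have "Fin_complex -` ecmod -` A = (\<lambda>z. ennreal (cmod z)) -` A \<inter> space borel" by auto
    also have "\<dots> \<in> sets borel" by measurable
    finally show "ecmod -` A \<inter> space ecomplex_borel \<in> sets ecomplex_borel"
      by (auto simp: ecomplex_borel_def intro!: sigma_sets.Basic)
  qed simp
qed

lemma ecmod_eq_0_iff: "ecmod z = 0 \<longleftrightarrow> z = Fin_complex 0"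
  by (cases z) (auto simp: ennreal_eq_0_iff)

text \<open>The level set at height \<open>s\<close> is \<open>E\<close> for \<open>s < 1\<close>
  and empty otherwise. Hence all heights compete in the infimum if \<open>m \<le> t\<close>, and
  only those with \<open>1 \<le> s\<close> if not.\<close>

lemma rearr_echi:
  assumes E: "E \<in> sets M" "emeasure M E = ennreal m" and m: "0 \<le> m" and t: "0 \<le> t"
  shows "rearr M (echi E) t = indicator {..<m} t"
proof -
  have "{x \<in> space M. ecmod (echi E x) > ennreal s} = (if s < 1 then E else {})" if "0 \<le> s" for s
    using that sets.sets_into_space[OF E(1)]
    by (auto simp: echi_def indicator_def ennreal_less_one_iff split: if_splits)
  then have iff: "emeasure M {x \<in> space M. ecmod (echi E x) > ennreal s} \<le> ennreal t
      \<longleftrightarrow> 1 \<le> s \<or> m \<le> t" if "0 \<le> s" for s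
    using that E m t by auto
  show ?thesis
  proof (cases "m \<le> t")
    case True
    then have "rearr M (echi E) t \<le> ennreal 0"
      unfolding rearr_def using iff[of 0] by (intro Inf_lower CollectI exI[of _ 0]) auto
    with True show ?thesis by simp
  next
    case False
    have "rearr M (echi E) t \<le> ennreal 1"
      unfolding rearr_def using iff[of 1] by (intro Inf_lower) auto
    moreover have "ennreal 1 \<le> rearr M (echi E) t"
      unfolding rearr_def using iff False by (intro Inf_greatest) (auto simp: ennreal_leI)
    ultimately show ?thesis using False by simp
  qed
qed

lemma max_rearr_echi:
  assumes "E \<in> sets M" "emeasure M E = ennreal m" "0 \<le> m" "0 < t"
  shows "max_rearr M (echi E) t = ennreal (min 1 (m / t))"
proof -
  have "(\<integral>\<^sup>+ s\<in>{0<..<t}. rearr M (echi E) s \<partial>lebesgue)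
      = (\<integral>\<^sup>+ s\<in>{0<..<t}. ennreal 1 * indicator {..<m} s \<partial>lebesgue)"
    using rearr_echi[OF assms(1-3)] by (intro nn_integral_cong) (auto simp: indicator_def)
  then show ?thesis
    using nn_integral_indicator_average[of t m 1] assms by (simp add: max_rearr_def)
qed

text \<open>A lower bound \<open>m\<close> replaces the exact measure because the level set may have
  infinite measure.\<close>

lemma max_rearr_ge:
  assumes [measurable]: "f \<in> M \<rightarrow>\<^sub>M ecomplex_borel"
    and m: "ennreal m \<le> emeasure M {x \<in> space M. ennreal c < ecmod (f x)}" "0 < m"
    and t: "0 < t"
  shows "ennreal c * ennreal (min 1 (m / t)) \<le> max_rearr M f t"
proof -
  have "ennreal c \<le> rearr M f s" if s: "s < m" for s
    unfolding rearr_def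
  proof (intro Inf_greatest, clarify)
    fix u :: real
    assume u: "emeasure M {x \<in> space M. ennreal u < ecmod (f x)} \<le> ennreal s"
    show "ennreal c \<le> ennreal u"
    proof (rule ccontr)
      assume "\<not> ennreal c \<le> ennreal u"
      then have "ennreal m \<le> emeasure M {x \<in> space M. ennreal u < ecmod (f x)}"
        by (intro order_trans[OF m(1)] emeasure_mono) auto
      with u have "ennreal m \<le> ennreal s" by simp
      with s m show False by (auto simp: ennreal_le_iff2)
    qed
  qed
  then have "(\<integral>\<^sup>+ s\<in>{0<..<t}. ennreal c * indicator {..<m} s \<partial>lebesgue)
      \<le> (\<integral>\<^sup>+ s\<in>{0<..<t}. rearr M f s \<partial>lebesgue)"
    by (intro nn_integral_mono) (auto simp: indicator_def)
  then show ?thesis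
    unfolding max_rearr_def nn_integral_indicator_average[OF t less_imp_le[OF m(2)], symmetric]
    by (rule divide_right_mono_ennreal)
qed

lemma max_rearr_eq_0:
  assumes "AE x in M. f x = Fin_complex 0"
  shows "max_rearr M f t = 0"
proof -
  have "rearr M f s = 0" for s
  proof -
    have "emeasure M {x \<in> space M. ecmod (f x) > ennreal 0} = 0"
      using assms by (intro emeasure_eq_0_AE) (auto elim!: eventually_mono)
    then have "rearr M f s \<le> ennreal 0"
      unfolding rearr_def by (intro Inf_lower CollectI exI[of _ 0]) auto
    then show ?thesis by simp
  qed
  then show ?thesis by (simp add: max_rearr_def)
qed

text \<open>The set where \<open>f\<close> is nonzero is the countable union of the level sets at
  heights \<open>1 / Suc n\<close>, so one of them is not null.\<close>

lemma not_null_imp_level_set: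
  assumes [measurable]: "f \<in> M \<rightarrow>\<^sub>M ecomplex_borel" and "\<not> (AE x in M. f x = Fin_complex 0)"
  obtains c m :: real where "0 < c" "0 < m"
    "ennreal m \<le> emeasure M {x \<in> space M. ennreal c < ecmod (f x)}"
proof -
  have "\<exists>n. \<not> (AE x in M. \<not> ennreal (1 / real (Suc n)) < ecmod (f x))"
  proof (rule ccontr)
    assume "\<not> ?thesis"
    then have "AE x in M. \<forall>n. \<not> ennreal (1 / real (Suc n)) < ecmod (f x)"
      by (auto simp: AE_all_countable)
    then have "AE x in M. f x = Fin_complex 0"
    proof eventually_elim
      case (elim x)
      have "ecmod (f x) = 0"
      proof (rule ccontr)
        assume "ecmod (f x) \<noteq> 0"
        then obtain z where z: "0 < z" "z < ecmod (f x)"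
          using dense[of 0 "ecmod (f x)"] by (auto simp: zero_less_iff_neq_zero)
        then obtain e where e: "0 < e" "ennreal e < ecmod (f x)" by (cases z) auto
        obtain n where "1 / real (Suc n) < e"
          using reals_Archimedean[OF e(1)] by (auto simp: inverse_eq_divide)
        then have "ennreal (1 / real (Suc n)) < ecmod (f x)"
          using e by (intro le_less_trans[OF ennreal_leI e(2)]) auto
        with elim show False by blast
      qed
      then show ?case by (simp add: ecmod_eq_0_iff)
    qed
    with assms(2) show False by contradiction
  qed
  then obtain n where n: "\<not> (AE x in M. \<not> ennreal (1 / real (Suc n)) < ecmod (f x))" by blast
  define A where "A = {x \<in> space M. ennreal (1 / real (Suc n)) < ecmod (f x)}"
  have "emeasure M A \<noteq> 0"
    using n by (subst (asm) AE_iff_measurable[where N = A]) (auto simp: A_def)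
  \<comment> \<open>Going strictly below the measure yields a finite positive \<open>m\<close> even
    if the level set has infinite measure.\<close>
  then obtain z where z: "0 < z" "z < emeasure M A"
    using dense[of 0 "emeasure M A"] by (auto simp: zero_less_iff_neq_zero)
  then obtain m where "0 < m" "ennreal m \<le> emeasure M A" by (cases z) auto
  then show thesis by (intro that[of "1 / real (Suc n)" m]) (auto simp: A_def)
qed

section \<open>The characterization of (P4) and the degenerate case\<close>

theorem proposition3p4:
  fixes M :: "'a measure" and p q :: ennreal and b :: "real \<Rightarrow> real"
  assumes "sigma_finite_measure M" and "nonatomic M" and "emeasure M (space M) = \<infinity>"
    and "0 < p" and "0 < q" and "slowly_varying b"
  shows "(property_P4 M (LK_norm M p q b) \<longleftrightarrow>
            (1 < p \<and> p < \<infinity>) \<or>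
            (p = 1 \<and> Lq_norm q (\<lambda>t. ennreal (t powr (- recip q) * b t * indicator {1<..} t)) < \<infinity>) \<or>
            (p = \<infinity> \<and> Lq_norm q (\<lambda>t. ennreal (t powr (- recip q) * b t * indicator {0<..<1} t)) < \<infinity>)) \<and>
         (\<not> ((1 < p \<and> p < \<infinity>) \<or>
             (p = 1 \<and> Lq_norm q (\<lambda>t. ennreal (t powr (- recip q) * b t * indicator {1<..} t)) < \<infinity>) \<or>
             (p = \<infinity> \<and> Lq_norm q (\<lambda>t. ennreal (t powr (- recip q) * b t * indicator {0<..<1} t)) < \<infinity>)) \<longrightarrow>
          LK_space M p q b = null_class M)"
    (is "(_ \<longleftrightarrow> ?cond) \<and> _")
proof -
  note [measurable] = slowly_varying_measurable[OF assms(6)]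
  \<comment> \<open>The explicit formula for \<open>max_rearr M (echi E) t\<close> is available only
    for \<open>t > 0\<close>, so the two integrands agree on the half-line but not as
    functions.\<close>
  have cong: "Lq_norm q g = Lq_norm q h"
    if "g \<in> borel_measurable halfline" "\<And>t. 0 < t \<Longrightarrow> h t = g t" for g h
  proof (rule antisym)
    have "h \<in> borel_measurable halfline"
      using that by (subst measurable_cong[where g = g]) auto
    then show "Lq_norm q g \<le> Lq_norm q h" "Lq_norm q h \<le> Lq_norm q g"
      using that by (auto intro!: Lq_norm_mono)
  qed
  have LK_echi: "LK_norm M p q b (echi E)
      = Lq_norm q (\<lambda>t. ennreal (t powr (recip p - recip q) * b t) * ennreal (min 1 (m / t)))"
    if "E \<in> sets M" "emeasure M E = ennreal m" "0 \<le> m" for E m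
    unfolding LK_norm_def using max_rearr_echi[OF that] by (intro cong[symmetric]) auto
  have P4: "property_P4 M (LK_norm M p q b)" if ?cond
    unfolding property_P4_def
  proof clarify
    fix E assume E: "E \<in> sets M" "emeasure M E < \<infinity>"
    then obtain m where m: "emeasure M E = ennreal m" "0 \<le> m" by (cases "emeasure M E") auto
    show "LK_norm M p q b (echi E) < \<infinity>"
      using Lq_norm_min_finite[OF assms(6,5) m(2)] that by (simp add: LK_echi[OF E(1) m])
  qed
  have null: "LK_space M p q b = null_class M" if not_cond: "\<not> ?cond"
  proof (intro equalityI subsetI)
    fix f assume f: "f \<in> LK_space M p q b"
    then have [measurable]: "f \<in> M \<rightarrow>\<^sub>M ecomplex_borel" by (simp add: LK_space_def)
    show "f \<in> null_class M"
    proof (rule ccontr)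
      assume "f \<notin> null_class M"
      then have "\<not> (AE x in M. f x = Fin_complex 0)" by (simp add: null_class_def)
      from not_null_imp_level_set[OF \<open>f \<in> M \<rightarrow>\<^sub>M ecomplex_borel\<close> this]
      obtain c m where c: "0 < c" and m: "0 < m"
        and le: "ennreal m \<le> emeasure M {x \<in> space M. ennreal c < ecmod (f x)}" .
      let ?w = "\<lambda>t. ennreal (t powr (recip p - recip q) * b t)"
      have "Lq_norm q (\<lambda>t. ?w t * (ennreal c * ennreal (min 1 (m / t)))) \<le> LK_norm M p q b f"
        unfolding LK_norm_def using m le
        by (intro Lq_norm_mono mult_left_mono max_rearr_ge) auto
      also have "\<dots> < top" using f by (simp add: LK_space_def)
      finally have fin: "Lq_norm q (\<lambda>t. ?w t * (ennreal c * ennreal (min 1 (m / t)))) < top" .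
      \<comment> \<open>The height \<open>c\<close> is removed by dominating with the constant
        \<open>1 / c\<close>; what remains is the quasinorm already known to be infinite.\<close>
      have "Lq_norm q (\<lambda>t. ?w t * ennreal (min 1 (m / t))) < top"
      proof (rule Lq_norm_dominated1[OF assms(5) _ _ _ _ fin])
        have "ennreal (1 / c) * ennreal c = 1" using c by (simp add: ennreal_mult[symmetric])
        then show "?w t * ennreal (min 1 (m / t))
            \<le> ennreal (1 / c) * (?w t * (ennreal c * ennreal (min 1 (m / t))))" for t
          by (metis mult.left_commute mult.assoc mult_1 order_refl)
      qed (use c in auto)
      with Lq_norm_min_infinite[OF assms(6,5) m assms(4)] not_cond show False by simp
    qed
  next
    fix f assume f: "f \<in> null_class M"
    then have "max_rearr M f t = 0" for t
      by (intro max_rearr_eq_0) (simp add: null_class_def)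
    then have "LK_norm M p q b f = 0" by (simp add: LK_norm_def Lq_norm_0)
    with f show "f \<in> LK_space M p q b" by (simp add: LK_space_def null_class_def)
  qed
  have "?cond" if P: "property_P4 M (LK_norm M p q b)"
  proof (rule ccontr)
    assume n: "\<not> ?cond"
    \<comment> \<open>A sigma-finite space of infinite measure has subsets of finite measure above
      any finite bound; the bound 0 provides a test set for (P4).\<close>
    obtain E where E: "E \<in> sets M" "emeasure M E < \<infinity>" "0 < emeasure M E"
      using sigma_finite_measure.approx_PInf_emeasure_with_finite[OF assms(1) sets.top assms(3), of 0]
      by (metis ennreal_0 zero_less_iff_neq_zero)
    then obtain m where m: "emeasure M E = ennreal m" "0 < m" by (cases "emeasure M E") auto
    from P E have "LK_norm M p q b (echi E) < \<infinity>" by (simp add: property_P4_def)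
    with Lq_norm_min_infinite[OF assms(6,5) m(2) assms(4) n[unfolded infinity_ennreal_def]]
    show False by (simp add: LK_echi[OF E(1) m(1)] m(2) less_imp_le)
  qed
  with P4 null show ?thesis by blast
qed

end
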